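(* Let $p=(p_k)_{k\in\mathbb{N}_0}$ be a probability distribution on $\mathbb{N}_0$ satisfying $$\sum_{k\in\mathbb{N}} (k\log k)\,p_k<\infty,\qquad p_0=0,\qquad p_1<1,$$ and let $\mathcal{T}_\infty$ be the infinite Galton-Watson tree with offspring distribution $p$. Let $S_k=\sum_{l=1}^kX_l$, where $(X_l)_{l=1}^k$ are drawn independently from $p$. If, for each $\tilde k$ in the support of the size-biased distribution $\tilde p$, the function $$k\mapsto\mathbb{P}\big(\tilde k+S_k-k(k+1)>0\big)\quad\text{is non-increasing on the support of }p,$$ then $$f^{++}\le\tilde f^{+}f^{+}.$$
   Context: Let $\mu=\sum_kkp_k$, and let $\tilde p=(\tilde p_k)_{k\in\mathbb{N}_0}$ with $\tilde p_k=kp_k/\mu$ be the size-biased distribution. Let $\tilde X$ be a random variable with distribution $\tilde p$, independent of the $X_l$'s. Empty sums are $0$, so $S_0=0$; terms with $\tilde k=0$ below have weight $\tilde p_0=0$ and are taken to be $0$. The quantities in the conclusion are $$f^+=\sum_{k\in\mathbb{N}_0}p_k\,\mathbb{P}\big(\tilde X+S_k-k(k+1)>0\big),\qquad \tilde f^{+}=\sum_{\tilde k\in\mathbb{N}_0}\tilde p_{\tilde k}\,\mathbb{P}\big(\tilde X+S_{\tilde k}-\tilde k(\tilde k+1)>0\big),$$ $$f^{++}=\sum_{\tilde k\in\mathbb{N}_0}\sum_{k\in\mathbb{N}_0}\tilde p_{\tilde k}\,p_k\,\mathbb{P}\big(\tilde X+S_{\tilde k-1}+k-\tilde k(\tilde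 k+1)>0\big)\,\mathbb{P}\big(\tilde k+S_k-k(k+1)>0\big).$$ Interpretation: a vertex $u$ of $\mathcal{T}_\infty$ is positive if $\frac1{d_u}\sum_{v\sim u}d_v-d_u>0$, where $d_u$ is the degree of $u$ and $v\sim u$ denotes adjacency. With $N_m$ the number of vertices at distance $\le m$ from the root, $f^+$ is the a.s. limit as $m\to\infty$ of the fraction of these vertices that are positive; $f^{++}$ is the a.s. limit of $1/N_m$ times the number of parent-child edges within distance $m$ of the root with both endpoints positive; and $\tilde f^+$ is the a.s. limit of $1/N_m$ times the number of such edges whose parent endpoint is positive. *)

theory Defs
  imports "HOL-Probability.Probability"
begin

definition mean :: "nat pmf \<Rightarrow> real" where
  "mean p = (\<Sum>k. real k * pmf p k)"

definition size_biased :: "nat pmf \<Rightarrow> nat \<Rightarrow> real" where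
  "size_biased p k = real k * pmf p k / mean p"

text \<open>
  The variables \<open>X l\<close> are indexed by \<open>l \<ge> 1\<close>; the value \<open>X 0\<close> is never used.
\<close>

definition S :: "(nat \<Rightarrow> 'a \<Rightarrow> nat) \<Rightarrow> nat \<Rightarrow> 'a \<Rightarrow> nat" where
  "S X k \<omega> = (\<Sum>l=1..k. X l \<omega>)"

text \<open>
  Joint independence of the family consisting of \<open>Xt\<close> (placed at the free index \<open>0\<close>)
  and all \<open>X l\<close>, \<open>l \<ge> 1\<close>: the \<open>X l\<close> are independent and \<open>Xt\<close> is independent of them.
\<close>

definition sampling ::
    "'a measure \<Rightarrow> nat pmf \<Rightarrow> (nat \<Rightarrow> 'a \<Rightarrow> nat) \<Rightarrow> ('a \<Rightarrow> nat) \<Rightarrow> bool" where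
  "sampling M p X Xt \<longleftrightarrow>
     prob_space M \<and>
     prob_space.indep_vars M (\<lambda>_. count_space UNIV) (\<lambda>l. if l = 0 then Xt else X l) UNIV \<and>
     (\<forall>l\<ge>1. distributed M (count_space UNIV) (X l) (\<lambda>k. ennreal (pmf p k))) \<and>
     distributed M (count_space UNIV) Xt (\<lambda>k. ennreal (size_biased p k))"

definition f_plus ::
    "'a measure \<Rightarrow> nat pmf \<Rightarrow> (nat \<Rightarrow> 'a \<Rightarrow> nat) \<Rightarrow> ('a \<Rightarrow> nat) \<Rightarrow> real" where
  "f_plus M p X Xt =
     (\<Sum>k. pmf p k *
        \<P>(\<omega> in M. int (Xt \<omega>) + int (S X k \<omega>) - int k * (int k + 1) > 0))"

definition f_plus_tilde ::
    "'a measure \<Rightarrow> nat pmf \<Rightarrow> (nat \<Rightarrow> 'a \<Rightarrow> nat) \<Rightarrow> ('a \<Rightarrow> nat) \<Rightarrow> real" where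
  "f_plus_tilde M p X Xt =
     (\<Sum>kt. size_biased p kt *
        \<P>(\<omega> in M. int (Xt \<omega>) + int (S X kt \<omega>) - int kt * (int kt + 1) > 0))"

text \<open>
  The truncated subtraction \<open>kt - 1\<close> is harmless: the term \<open>kt = 0\<close> has weight
  \<open>size_biased p 0 = 0\<close>.
\<close>

definition f_plus_plus ::
    "'a measure \<Rightarrow> nat pmf \<Rightarrow> (nat \<Rightarrow> 'a \<Rightarrow> nat) \<Rightarrow> ('a \<Rightarrow> nat) \<Rightarrow> real" where
  "f_plus_plus M p X Xt =
     (\<Sum>kt. \<Sum>k. size_biased p kt * pmf p k *
        \<P>(\<omega> in M. int (Xt \<omega>) + int (S X (kt - 1) \<omega>) + int k - int kt * (int kt + 1) > 0) *
        \<P>(\<omega> in M. int kt + int (S X k \<omega>) - int k * (int k + 1) > 0))"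

end

theory Submission imports Defs begin

text \<open>
  The bound follows from two applications of Chebyshev's association inequality: an increasing
  and a decreasing function of the same random variable are negatively correlated
  (\<open>pmf_expectation_mult_le\<close>).

  Write \<open>B kt k = \<P>(kt + S k - k (k + 1) > 0)\<close>, the probability that a child with \<open>k\<close> children is
  positive when its parent has \<open>kt\<close> children, and
  \<open>A kt k = \<P>(Xt + S (kt - 1) + k - kt (kt + 1) > 0)\<close>, the probability that this parent is
  positive when that child has \<open>k\<close> children.
  Then \<open>f\<^sup>+\<^sup>+\<close> is the expectation of \<open>A kt k * B kt k\<close> for independent \<open>kt\<close> (size-biased) and \<open>k\<close>
  (with law \<open>p\<close>).

  \<^item> Fix \<open>kt\<close> in the support of the size-biased law. As a function of \<open>k\<close>, \<open>A kt k\<close> increases and \<open>B kt k\<close> decreases on the support of \<open>p\<close>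
    by hypothesis, so the average of the product over \<open>k\<close> is at most \<open>C kt * D kt\<close>, the product of
    the averages. Averaging \<open>A kt k\<close> over \<open>k\<close> replaces \<open>k\<close> by one further independent
    copy of \<open>X\<close>, hence \<open>C kt = \<P>(Xt + S kt - kt (kt + 1) > 0)\<close>.

  \<^item> Now let \<open>kt\<close> vary. \<open>D\<close> increases since \<open>B kt k\<close> increases in \<open>kt\<close>. Conditioning on \<open>Xt\<close>
    shows that \<open>C k\<close> is the size-biased average of \<open>B kt k\<close> over \<open>kt\<close>, so the hypothesis makes \<open>C\<close>
    decrease on the support of \<open>p\<close>, which contains that of the size-biased law. Hence the average of
    \<open>C * D\<close> is at most the product of the averages of \<open>C\<close> and \<open>D\<close>. The first is the
    quantity \<open>f_plus_tilde\<close>; the second is \<open>f\<^sup>+\<close>, by Fubini.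

  The conditioning steps are instances of \<open>prob_eq_expectation_of_indep_var\<close>.
\<close>

section \<open>Expectations under discrete distributions\<close>

lemma integrable_measure_pmf_prob:
  assumes "\<And>x. 0 \<le> f x" "\<And>x. f x \<le> (1::real)"
  shows "integrable (measure_pmf p) f"
  by (rule measure_pmf.integrable_const_bound[where B = 1]) (use assms in auto)

lemma pmf_expectation_sums:
  fixes p :: "nat pmf" and f :: "nat \<Rightarrow> real"
  assumes "integrable (measure_pmf p) f"
  shows "(\<lambda>k. pmf p k * f k) sums measure_pmf.expectation p f"
proof -
  have "integrable (count_space UNIV) (\<lambda>k. pmf p k * f k)"
    using assms by (simp add: measure_pmf_eq_density integrable_real_density)
  then have "(\<lambda>k. pmf p k * f k) sums (LINT k|count_space UNIV. pmf p k * f k)"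
    by (rule sums_integral_count_space_nat)
  also have "(LINT k|count_space UNIV. pmf p k * f k) = measure_pmf.expectation p f"
    by (simp add: measure_pmf_eq_density integral_real_density)
  finally show ?thesis .
qed

lemma pmf_expectation_swap:
  fixes p :: "'a::countable pmf" and q :: "'b::countable pmf" and f :: "'a \<Rightarrow> 'b \<Rightarrow> real"
  assumes "\<And>x y. 0 \<le> f x y" "\<And>x y. f x y \<le> 1"
  shows "measure_pmf.expectation q (\<lambda>y. measure_pmf.expectation p (\<lambda>x. f x y)) =
         measure_pmf.expectation p (\<lambda>x. measure_pmf.expectation q (\<lambda>y. f x y))"
proof -
  interpret pair_prob_space "measure_pmf p" "measure_pmf q" ..
  have "sets (measure_pmf p \<Otimes>\<^sub>M measure_pmf q) =
        sets (count_space UNIV \<Otimes>\<^sub>M (count_space UNIV :: 'b measure))"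
    by (intro sets_pair_measure_cong) simp_all
  also have "\<dots> = sets (count_space (UNIV :: ('a \<times> 'b) set))"
    by (subst pair_measure_countable) simp_all
  finally have sets: "sets (measure_pmf p \<Otimes>\<^sub>M measure_pmf q) = sets (count_space UNIV)" .
  have "case_prod f \<in> borel_measurable (measure_pmf p \<Otimes>\<^sub>M measure_pmf q)"
    by (subst measurable_cong_sets[OF sets refl]) simp
  then have "integrable (measure_pmf p \<Otimes>\<^sub>M measure_pmf q) (case_prod f)"
    by (intro P.integrable_const_bound[where B = 1] AE_I2) (use assms in \<open>auto simp: abs_of_nonneg\<close>)
  then show ?thesis by (rule Fubini_integral)
qed

text \<open>
  Chebyshev's association inequality. For all \<open>x\<close>, \<open>y\<close> in the support, \<open>f x - f y\<close> and \<open>g x - g y\<close>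
  have opposite signs; averaging \<open>(f x - f y) * (g x - g y) \<le> 0\<close> first over \<open>x\<close> and then over an
  independent copy \<open>y\<close> gives twice the claim.
\<close>

lemma pmf_expectation_mult_le:
  fixes p :: "'a::linorder pmf" and f g :: "'a \<Rightarrow> real"
  assumes f: "mono_on (set_pmf p) f" and g: "antimono_on (set_pmf p) g"
    and int [simp]: "integrable (measure_pmf p) f" "integrable (measure_pmf p) g"
      "integrable (measure_pmf p) (\<lambda>x. f x * g x)"
  shows "measure_pmf.expectation p (\<lambda>x. f x * g x) \<le>
         measure_pmf.expectation p f * measure_pmf.expectation p g"
proof -
  let ?E = "measure_pmf.expectation p"
  have sign: "(f x - f y) * (g x - g y) \<le> 0" if "x \<in> set_pmf p" "y \<in> set_pmf p" for x y
  proof (cases "x \<le> y")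
    case True
    then have "f x \<le> f y" "g y \<le> g x"
      using f g that by (auto simp: monotone_on_def)
    then show ?thesis by (simp add: mult_nonpos_nonneg)
  next
    case False
    then have "f y \<le> f x" "g x \<le> g y"
      using f g that by (auto simp: monotone_on_def)
    then show ?thesis by (simp add: mult_nonneg_nonpos)
  qed
  have "?E (\<lambda>x. f x * g x) - g y * ?E f - f y * ?E g + f y * g y \<le> 0" if y: "y \<in> set_pmf p" for y
  proof -
    have "?E (\<lambda>x. f x * g x) - g y * ?E f - f y * ?E g + f y * g y =
          ?E (\<lambda>x. f x * g x - g y * f x - f y * g x + f y * g y)"
      by simp
    also have "\<dots> \<le> ?E (\<lambda>_. 0)"
      using sign[OF _ y] by (intro integral_mono_AE) (auto simp: AE_measure_pmf_iff algebra_simps)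
    finally show ?thesis by simp
  qed
  then have "?E (\<lambda>y. ?E (\<lambda>x. f x * g x) - g y * ?E f - f y * ?E g + f y * g y) \<le> ?E (\<lambda>_. 0)"
    by (intro integral_mono_AE) (auto simp: AE_measure_pmf_iff)
  also have "?E (\<lambda>y. ?E (\<lambda>x. f x * g x) - g y * ?E f - f y * ?E g + f y * g y) =
             2 * (?E (\<lambda>x. f x * g x) - ?E f * ?E g)"
    by (simp add: algebra_simps)
  finally show ?thesis by simp
qed

section \<open>Conditioning on an independent variable\<close>

lemma (in prob_space) indep_var_sum_sum:
  fixes W :: "'i \<Rightarrow> 'a \<Rightarrow> nat"
  assumes ind: "indep_vars (\<lambda>_. count_space UNIV) W I"
    and AB: "A \<inter> B = {}" "A \<subseteq> I" "B \<subseteq> I"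
  shows "indep_var (count_space UNIV) (\<lambda>\<omega>. \<Sum>i\<in>A. W i \<omega>) (count_space UNIV) (\<lambda>\<omega>. \<Sum>i\<in>B. W i \<omega>)"
proof -
  have borel: "N \<rightarrow>\<^sub>M borel = N \<rightarrow>\<^sub>M count_space (UNIV :: nat set)" for N :: "('i \<Rightarrow> nat) measure"
    by (rule measurable_cong_sets) (simp_all add: sets_borel_eq_count_space)
  have meas: "(\<lambda>w. \<Sum>i\<in>J. w i) \<in> (\<Pi>\<^sub>M i\<in>J. count_space UNIV) \<rightarrow>\<^sub>M count_space (UNIV :: nat set)"
    for J :: "'i set"
    unfolding borel[symmetric]
    by (rule borel_measurable_sum) (simp add: borel measurable_component_singleton)
  show ?thesis
    using indep_var_compose[OF indep_var_restrict[OF ind AB] meas meas]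
    by (simp add: comp_def)
qed

lemma (in prob_space) prob_eq_expectation_of_indep_var:
  fixes Y Z :: "'a \<Rightarrow> nat"
  assumes ind: "indep_var (count_space UNIV) Y (count_space UNIV) Z"
    and Z: "distr M (count_space UNIV) Z = measure_pmf r"
  shows "\<P>(\<omega> in M. Q (Y \<omega>) (Z \<omega>)) = measure_pmf.expectation r (\<lambda>k. \<P>(\<omega> in M. Q (Y \<omega>) k))"
proof -
  have [measurable]: "Y \<in> M \<rightarrow>\<^sub>M count_space UNIV" "Z \<in> M \<rightarrow>\<^sub>M count_space UNIV"
    using ind by (auto dest: indep_var_rv1 indep_var_rv2)
  have slice: "{\<omega> \<in> space M. Z \<omega> = k \<and> Q (Y \<omega>) k} =
               (\<lambda>\<omega>. (Y \<omega>, Z \<omega>)) -` ({y. Q y k} \<times> {k}) \<inter> space M" for k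
    by auto
  have sets: "{\<omega> \<in> space M. Z \<omega> = k \<and> Q (Y \<omega>) k} \<in> events" for k
    by measurable
  have prob_slice: "\<P>(\<omega> in M. Z \<omega> = k \<and> Q (Y \<omega>) k) = pmf r k * \<P>(\<omega> in M. Q (Y \<omega>) k)" for k
  proof -
    have "prob (Z -` {k} \<inter> space M) = pmf r k"
      by (subst measure_distr[symmetric, where N = "count_space UNIV"])
        (auto simp: Z measure_pmf_single)
    moreover have "Y -` {y. Q y k} \<inter> space M = {\<omega> \<in> space M. Q (Y \<omega>) k}"
      by auto
    ultimately show ?thesis
      unfolding slice by (subst indep_varD[OF ind]) simp_all
  qed
  have union: "{\<omega> \<in> space M. Q (Y \<omega>) (Z \<omega>)} = (\<Union>k. {\<omega> \<in> space M. Z \<omega> = k \<and> Q (Y \<omega>) k})"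
    by auto
  then have "{\<omega> \<in> space M. Q (Y \<omega>) (Z \<omega>)} \<in> events"
    using sets by auto
  then have "(\<lambda>k. \<P>(\<omega> in M. Z \<omega> = k \<and> Q (Y \<omega>) k)) sums \<P>(\<omega> in M. Q (Y \<omega>) (Z \<omega>))"
    by (intro prob_sums sets) auto
  moreover have "(\<lambda>k. pmf r k * \<P>(\<omega> in M. Q (Y \<omega>) k)) sums
      measure_pmf.expectation r (\<lambda>k. \<P>(\<omega> in M. Q (Y \<omega>) k))"
    by (intro pmf_expectation_sums integrable_measure_pmf_prob) auto
  ultimately show ?thesis
    by (simp add: prob_slice sums_unique2)
qed

section \<open>The size-biased law\<close>

text \<open>
  The total mass one of the density of \<open>Xt\<close> forces the mean of \<open>p\<close> to be positive: with a
  nonpositive mean all weights would be nonpositive and hence vanish in \<open>ennreal\<close>. A positive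
  mean makes all weights nonnegative, so the density is a probability mass function.
\<close>

lemma size_biased_pmf_exists:
  assumes "prob_space M"
    and Xt: "distributed M (count_space UNIV) Xt (\<lambda>k. ennreal (size_biased p k))"
  obtains q where "\<And>k. pmf q k = size_biased p k"
    and "distr M (count_space UNIV) Xt = measure_pmf q"
proof -
  interpret prob_space M by fact
  have distr: "distr M (count_space UNIV) Xt = density (count_space UNIV) (\<lambda>k. ennreal (size_biased p k))"
    using Xt by (rule distributed_distr_eq_density)
  have "prob_space (distr M (count_space UNIV) Xt)"
    using Xt by (intro prob_space_distr distributed_measurable)
  from prob_space.emeasure_space_1[OF this]
  have total: "(\<integral>\<^sup>+k. ennreal (size_biased p k) \<partial>count_space UNIV) = 1"
    unfolding distr by (simp add: emeasure_density)
  have "mean p > 0"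
  proof (rule ccontr)
    assume "\<not> mean p > 0"
    then have "ennreal (size_biased p k) = 0" for k
      by (simp add: size_biased_def ennreal_eq_0_iff divide_nonneg_nonpos)
    with total show False by simp
  qed
  then have nonneg: "size_biased p k \<ge> 0" for k
    by (simp add: size_biased_def)
  have pmf: "pmf (embed_pmf (size_biased p)) k = size_biased p k" for k
    by (rule pmf_embed_pmf[OF nonneg total])
  show ?thesis
    by (rule that[of "embed_pmf (size_biased p)"]) (simp_all add: pmf distr measure_pmf_eq_density)
qed

section \<open>Negative correlation across an edge\<close>

theorem theorem1p8:
  fixes M :: "'a measure" and p :: "nat pmf"
    and X :: "nat \<Rightarrow> 'a \<Rightarrow> nat" and Xt :: "'a \<Rightarrow> nat"
  assumes "summable (\<lambda>k. real k * ln (real k) * pmf p k)"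
    and "pmf p 0 = 0"
    and "pmf p 1 < 1"
    and "sampling M p X Xt"
    and "\<And>kt. size_biased p kt \<noteq> 0 \<Longrightarrow>
           antimono_on (set_pmf p)
             (\<lambda>k. \<P>(\<omega> in M. int kt + int (S X k \<omega>) - int k * (int k + 1) > 0))"
  shows "f_plus_plus M p X Xt \<le> f_plus_tilde M p X Xt * f_plus M p X Xt"
proof -
  \<comment> \<open>One independent family, so that \<open>Xt + S k\<close> is its sum over \<open>{0..k}\<close>.\<close>
  define W where "W = (\<lambda>l. if l = 0 then Xt else X l)"
  have "prob_space M" and ind: "prob_space.indep_vars M (\<lambda>_. count_space UNIV) W UNIV"
    and X: "\<And>l. l \<ge> 1 \<Longrightarrow> distributed M (count_space UNIV) (X l) (\<lambda>k. ennreal (pmf p k))"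
    and Xt: "distributed M (count_space UNIV) Xt (\<lambda>k. ennreal (size_biased p k))"
    using assms(4) by (auto simp: sampling_def W_def)
  interpret prob_space M by fact
  obtain q where q: "\<And>k. pmf q k = size_biased p k"
    and distr_Xt: "distr M (count_space UNIV) Xt = measure_pmf q"
    using size_biased_pmf_exists[OF \<open>prob_space M\<close> Xt] by blast
  have distr_X: "distr M (count_space UNIV) (X l) = measure_pmf p" if "l \<ge> 1" for l
    using distributed_distr_eq_density[OF X[OF that]] by (simp add: measure_pmf_eq_density)
  have sum_W: "(\<Sum>i\<in>{1..k}. W i \<omega>) = S X k \<omega>" for k \<omega>
    by (simp add: W_def S_def)
  have sum_W0: "(\<Sum>i\<in>{0..k}. W i \<omega>) = Xt \<omega> + S X k \<omega>" for k \<omega>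
    by (simp add: sum.atLeast_Suc_atMost S_def W_def)
  have S_measurable: "S X k \<in> M \<rightarrow>\<^sub>M count_space UNIV" for k
    using indep_var_rv1[OF indep_var_sum_sum[OF ind, of "{1..k}" "{}"]] by (simp only: sum_W) simp
  have Xt_S_measurable: "(\<lambda>\<omega>. Xt \<omega> + S X k \<omega>) \<in> M \<rightarrow>\<^sub>M count_space UNIV" for k
    using indep_var_rv1[OF indep_var_sum_sum[OF ind, of "{0..k}" "{}"]] by (simp only: sum_W0) simp

  have event: "{\<omega> \<in> space M. Q (Y \<omega>)} \<in> events" if "Y \<in> M \<rightarrow>\<^sub>M count_space UNIV"
    for Y :: "'a \<Rightarrow> nat" and Q
    using measurable_sets[OF that, of "Collect Q"] by (simp add: vimage_def Int_def conj_commute)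

  define A where "A = (\<lambda>kt k. \<P>(\<omega> in M.
    int (Xt \<omega>) + int (S X (kt - 1) \<omega>) + int k - int kt * (int kt + 1) > 0))"
  define B where "B = (\<lambda>kt k. \<P>(\<omega> in M. int kt + int (S X k \<omega>) - int k * (int k + 1) > 0))"
  define C where "C = (\<lambda>k. \<P>(\<omega> in M. int (Xt \<omega>) + int (S X k \<omega>) - int k * (int k + 1) > 0))"
  define D where "D = (\<lambda>kt. measure_pmf.expectation p (B kt))"

  have A01: "0 \<le> A kt k" "A kt k \<le> 1" and B01: "0 \<le> B kt k" "B kt k \<le> 1"
    and C01: "0 \<le> C k" "C k \<le> 1" for kt k
    by (simp_all add: A_def B_def C_def)
  have int_B: "integrable (measure_pmf r) (B kt)" and int_B': "integrable (measure_pmf r) (\<lambda>kt. B kt k)"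
    and int_AB: "integrable (measure_pmf r) (\<lambda>k. A kt k * B kt k)"
    and int_A: "integrable (measure_pmf r) (A kt)" for r kt k
    by (intro integrable_measure_pmf_prob; simp add: A01 B01 mult_le_one)+
  have int_C: "integrable (measure_pmf r) C" for r
    by (intro integrable_measure_pmf_prob) (simp_all add: C01)
  have D01: "0 \<le> D kt" "D kt \<le> 1" for kt
    using measure_pmf.integral_le_const[OF int_B[of p kt], of 1] B01
    by (simp_all add: D_def integral_nonneg_AE)

  have supp: "kt \<in> set_pmf p" "kt \<ge> 1" "size_biased p kt \<noteq> 0" if "kt \<in> set_pmf q" for kt
  proof -
    show nz: "size_biased p kt \<noteq> 0"
      using that by (simp add: set_pmf_iff q)
    then show "kt \<in> set_pmf p" "kt \<ge> 1"
      by (auto simp: size_biased_def set_pmf_iff intro: Suc_leI gr0I)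
  qed

  have A_mono: "mono_on (set_pmf p) (A kt)" for kt
  proof (rule monotone_onI)
    fix k k' :: nat assume "k \<le> k'"
    then show "A kt k \<le> A kt k'"
      unfolding A_def
      using event[OF Xt_S_measurable[of "kt - 1"], of "\<lambda>n. int n + int k' - int kt * (int kt + 1) > 0"]
      by (intro finite_measure_mono) auto
  qed
  have B_mono: "B kt k \<le> B kt' k" if "kt \<le> kt'" for kt kt' k
    unfolding B_def
    using that event[OF S_measurable[of k], of "\<lambda>n. int kt' + int n - int k * (int k + 1) > 0"]
    by (intro finite_measure_mono) auto
  have B_antimono: "antimono_on (set_pmf p) (B kt)" if "kt \<in> set_pmf q" for kt
    unfolding B_def using assms(5) supp(3)[OF that] by blast

  have C_eq_A: "C kt = measure_pmf.expectation p (A kt)" if "kt \<ge> 1" for kt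
  proof -
    have last: "(\<Sum>i\<in>{kt}. W i \<omega>) = X kt \<omega>" for \<omega>
      using that by (simp add: W_def)
    have "indep_var (count_space UNIV) (\<lambda>\<omega>. Xt \<omega> + S X (kt - 1) \<omega>) (count_space UNIV) (X kt)"
      using indep_var_sum_sum[OF ind, of "{0..kt - 1}" "{kt}"] that
      unfolding sum_W0 last by simp
    from prob_eq_expectation_of_indep_var[OF this distr_X[OF that],
        where Q = "\<lambda>y k. int y + int k - int kt * (int kt + 1) > 0"]
    have "measure_pmf.expectation p (A kt) =
      \<P>(\<omega> in M. int (Xt \<omega> + S X (kt - 1) \<omega>) + int (X kt \<omega>) - int kt * (int kt + 1) > 0)"
      by (simp add: A_def)
    also have "S X kt \<omega> = S X (kt - 1) \<omega> + X kt \<omega>" for \<omega>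
      using that by (cases kt) (simp_all add: S_def)
    then have "\<P>(\<omega> in M. int (Xt \<omega> + S X (kt - 1) \<omega>) + int (X kt \<omega>) - int kt * (int kt + 1) > 0)
      = C kt"
      by (simp add: C_def add.assoc)
    finally show ?thesis by simp
  qed

  have C_eq_B: "C k = measure_pmf.expectation q (\<lambda>kt. B kt k)" for k
  proof -
    have first: "(\<Sum>i\<in>{0}. W i \<omega>) = Xt \<omega>" for \<omega>
      by (simp add: W_def)
    have "indep_var (count_space UNIV) (S X k) (count_space UNIV) Xt"
      using indep_var_sum_sum[OF ind, of "{1..k}" "{0}"]
      unfolding sum_W first by simp
    from prob_eq_expectation_of_indep_var[OF this distr_Xt,
        where Q = "\<lambda>y kt. int kt + int y - int k * (int k + 1) > 0"]
    show ?thesis by (simp add: C_def B_def)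
  qed

  have C_antimono: "antimono_on (set_pmf q) C"
  proof (rule monotone_onI)
    fix x y assume xy: "x \<in> set_pmf q" "y \<in> set_pmf q" "x \<le> y"
    have "measure_pmf.expectation q (\<lambda>kt. B kt y) \<le> measure_pmf.expectation q (\<lambda>kt. B kt x)"
    proof (intro integral_mono_AE int_B')
      show "AE kt in measure_pmf q. B kt y \<le> B kt x"
        using B_antimono supp(1) xy by (auto simp: AE_measure_pmf_iff monotone_on_def)
    qed
    then show "C y \<le> C x" by (simp add: C_eq_B)
  qed
  have D_mono: "mono_on (set_pmf q) D"
    unfolding D_def by (intro monotone_onI integral_mono int_B B_mono)

  have per_parent: "measure_pmf.expectation p (\<lambda>k. A kt k * B kt k) \<le> D kt * C kt"
    if "kt \<in> set_pmf q" for kt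
    using pmf_expectation_mult_le[OF A_mono B_antimono[OF that] int_A int_B int_AB]
    by (simp add: D_def C_eq_A[OF supp(2)[OF that]] mult.commute)

  have int_DC: "integrable (measure_pmf q) (\<lambda>kt. D kt * C kt)"
    and int_D: "integrable (measure_pmf q) D"
    by (intro integrable_measure_pmf_prob; simp add: C01 D01 mult_le_one)+
  define E where "E = (\<lambda>kt. measure_pmf.expectation p (\<lambda>k. A kt k * B kt k))"
  have E01: "0 \<le> E kt" "E kt \<le> 1" for kt
    using measure_pmf.integral_le_const[OF int_AB[of p kt], of 1] A01 B01
    by (simp_all add: E_def integral_nonneg_AE mult_le_one)
  have int_E: "integrable (measure_pmf q) E"
    by (intro integrable_measure_pmf_prob) (simp_all add: E01)

  have "f_plus_plus M p X Xt = (\<Sum>kt. \<Sum>k. pmf q kt * (pmf p k * (A kt k * B kt k)))"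
    by (simp add: f_plus_plus_def A_def B_def q mult.assoc)
  also have "\<dots> = (\<Sum>kt. pmf q kt * E kt)"
    using sums_mult[OF pmf_expectation_sums[OF int_AB]]
    by (intro suminf_cong) (simp add: E_def sums_iff)
  also have "\<dots> = measure_pmf.expectation q E"
    using pmf_expectation_sums[OF int_E] by (simp add: sums_iff)
  also have "\<dots> \<le> measure_pmf.expectation q (\<lambda>kt. D kt * C kt)"
    using per_parent by (intro integral_mono_AE int_E int_DC) (auto simp: AE_measure_pmf_iff E_def)
  also have "\<dots> \<le> measure_pmf.expectation q D * measure_pmf.expectation q C"
    by (rule pmf_expectation_mult_le[OF D_mono C_antimono int_D int_C int_DC])
  also have "measure_pmf.expectation q D = measure_pmf.expectation p C"
    unfolding D_def C_eq_B by (rule pmf_expectation_swap) (simp_all add: B01)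
  also have "measure_pmf.expectation p C = f_plus M p X Xt"
    using pmf_expectation_sums[OF int_C[of p]] by (simp add: sums_iff f_plus_def C_def)
  also have "measure_pmf.expectation q C = f_plus_tilde M p X Xt"
    using pmf_expectation_sums[OF int_C[of q]] by (simp add: sums_iff f_plus_tilde_def C_def q)
  finally show ?thesis by (simp add: mult.commute)
qed

end
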